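(* Let $G\in\mathbb{R}^{n\times n}$ be an irreducible stochastic matrix with stationary distribution $\mu>0$, and let $\hat\mu\in\mathbb{R}^n$ with $\hat\mu>0$ and $\hat\mu^\top \mathbf{1}_n=1$ be a given target stationary distribution. For $\alpha\in\mathbb{R}^n$ with $\mathbf{0}_n\le\alpha\le\mathbf{1}_n$ let $D(\alpha)=\mathrm{Diag}(\alpha_1,\dots,\alpha_n)$, $\Delta(\alpha)=D(\alpha)(I_n-G)$ and $G(\alpha)=G+\Delta(\alpha)$. Then the set of parameters $\alpha$ with $\mathbf{0}_n\le\alpha<\mathbf{1}_n$ for which $G(\alpha)$ has $\hat\mu$ as stationary distribution, that is, $G(\alpha)^\top\hat\mu=\hat\mu$, is exactly $$\Big\{\alpha(c)=\mathbf{1}_n-c\,(\mu./\hat\mu)\ :\ 0<c\le 1/\|\mu./\hat\mu\|_\infty\Big\}.$$ Moreover, the parameter vector $\alpha^*=\alpha(c^* )$ of minimum norm in this set is obtained for $c^*=1/\|\mu./\hat\mu\|_\infty$, and it also minimizes the norm of the perturbation matrix $\Delta(\alpha)=D(\alpha)(I_n-G)$ over this set, for any monotone norm $\|\cdot\|$.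
   Context: All inequalities between vectors and matrices are entrywise. $\mathbf{0}_n,\mathbf{1}_n$ are the all-zeros and all-ones vectors in $\mathbb{R}^n$, and $I_n$ is the identity matrix. A matrix $G\in\mathbb{R}^{n\times n}$ is stochastic if $G\ge 0$ and $G\mathbf{1}_n=\mathbf{1}_n$. It is irreducible if there is no partition of $\{1,\dots,n\}$ into two nonempty disjoint sets $\mathcal I,\mathcal J$ with $G_{i,j}=0$ for all $i\in\mathcal I$, $j\in\mathcal J$. The stationary distribution of an irreducible stochastic $G$ is the unique vector $\mu>0$ with $\mu^\top G=\mu^\top$ and $\mu^\top\mathbf{1}_n=1$. $\mu./\hat\mu$ denotes the entrywise quotient, with entries $\mu_i/\hat\mu_i$. A norm $\|\cdot\|$ on matrices (or vectors) is monotone if $|A|\ge|B|$ entrywise implies $\|A\|\ge\|B\|$; "minimum norm" for the parameter vector $\alpha$ is understood with respect to any monotone vector norm. *)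

theory Defs
  imports "HOL-Analysis.Analysis"
begin

text \<open>
  Non-strict inequalities use the library order on vectors and matrices, which is entrywise.
  The library's \<open><\<close> on vectors is not entrywise, so strict inequalities are spelled
  out by components. On vectors, \<open>1\<close> is the all-ones vector; the identity matrix is \<open>mat 1\<close>.
\<close>

definition stochastic :: "real^'n^'n \<Rightarrow> bool" where
  "stochastic G \<longleftrightarrow> 0 \<le> G \<and> G *v 1 = 1"

definition irreducible_matrix :: "real^'n^'n \<Rightarrow> bool" where
  "irreducible_matrix G \<longleftrightarrow>
     \<not> (\<exists>I J. I \<noteq> {} \<and> J \<noteq> {} \<and> I \<inter> J = {} \<and> I \<union> J = UNIV \<and>
            (\<forall>i\<in>I. \<forall>j\<in>J. G $ i $ j = 0))"

text \<open>
  The notion is reserved for irreducible stochastic matrices, for which the vector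
  \<open>m\<close> is unique by Perron--Frobenius theory.
\<close>
definition is_stationary_distribution :: "real^'n^'n \<Rightarrow> real^'n \<Rightarrow> bool" where
  "is_stationary_distribution G m \<longleftrightarrow>
     stochastic G \<and> irreducible_matrix G \<and>
     (\<forall>i. 0 < m $ i) \<and> m v* G = m \<and> m \<bullet> 1 = 1"

definition Diag :: "real^'n \<Rightarrow> real^'n^'n" where
  "Diag a = (\<chi> i j. if i = j then a $ i else 0)"

definition perturbation :: "real^'n^'n \<Rightarrow> real^'n \<Rightarrow> real^'n^'n" where
  "perturbation G a = Diag a ** (mat 1 - G)"

definition perturbed :: "real^'n^'n \<Rightarrow> real^'n \<Rightarrow> real^'n^'n" where
  "perturbed G a = G + perturbation G a"

definition quotient_vec :: "real^'n \<Rightarrow> real^'n \<Rightarrow> real^'n" where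
  "quotient_vec m m' = (\<chi> i. m $ i / m' $ i)"

definition target_params :: "real^'n^'n \<Rightarrow> real^'n \<Rightarrow> (real^'n) set" where
  "target_params G m' =
     {a. 0 \<le> a \<and> (\<forall>i. a $ i < 1) \<and> is_stationary_distribution (perturbed G a) m'}"

definition alpha_param :: "real^'n \<Rightarrow> real^'n \<Rightarrow> real \<Rightarrow> real^'n" where
  "alpha_param m m' c = 1 - c *\<^sub>R quotient_vec m m'"

definition is_norm :: "('a::real_vector \<Rightarrow> real) \<Rightarrow> bool" where
  "is_norm N \<longleftrightarrow>
     (\<forall>x. 0 \<le> N x) \<and> (\<forall>x. N x = 0 \<longleftrightarrow> x = 0) \<and>
     (\<forall>r x. N (r *\<^sub>R x) = \<bar>r\<bar> * N x) \<and> (\<forall>x y. N (x + y) \<le> N x + N y)"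

text \<open>
  The modulus and order of \<open>ordered_euclidean_space\<close> are entrywise both on
  \<open>real^'n\<close> and on \<open>real^'n^'n\<close>, so this covers vector and matrix norms.
\<close>
definition monotone_norm :: "('a::ordered_euclidean_space \<Rightarrow> real) \<Rightarrow> bool" where
  "monotone_norm N \<longleftrightarrow> is_norm N \<and> (\<forall>x y. \<bar>y\<bar> \<le> \<bar>x\<bar> \<longrightarrow> N y \<le> N x)"

end

theory Submission
  imports Defs
begin

text \<open>
  Write \<open>q\<close> for \<open>\<mu>./\<mu>'\<close>. The equation \<open>\<mu>'\<^sup>T G(\<alpha>) = \<mu>'\<^sup>T\<close> says exactly that the vector
  \<open>w\<close> with entries \<open>(1 - \<alpha>\<^sub>i) \<mu>'\<^sub>i\<close> satisfies \<open>w\<^sup>T G = w\<^sup>T\<close>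
  (\<open>perturbed_fixed_iff\<close>). If \<open>\<alpha> < 1\<close> then \<open>w\<close> is positive, and a positive left fixed vector
  of an irreducible nonnegative matrix is unique up to scaling
  (\<open>positive_left_fixed_vector_unique\<close>), so \<open>w = c \<mu>\<close> with \<open>c > 0\<close>, which is
  \<open>\<alpha> = 1 - c q\<close>. The constraint \<open>\<alpha> \<ge> 0\<close> then reads \<open>c q\<^sub>i \<le> 1\<close> for all \<open>i\<close>, that is
  \<open>c \<le> 1 / \<parallel>q\<parallel>\<^sub>\<infinity>\<close>. For \<open>0 \<le> \<alpha> < 1\<close> the matrix \<open>G(\<alpha>)\<close> is again stochastic and irreducible,
  because row \<open>i\<close> is a convex combination of row \<open>i\<close> of \<open>G\<close>, with positive weight
  \<open>1 - \<alpha>\<^sub>i\<close>, and the \<open>i\<close>-th unit vector; so solving the fixed point equation is enough.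

  The feasible parameters therefore form a chain for the entrywise order, decreasing in \<open>c\<close>,
  and \<open>\<alpha>\<^sup>*\<close> is its least element. Entrywise \<open>\<bar>\<Delta>(\<alpha>)\<bar> = D(\<alpha>) \<bar>I - G\<bar>\<close> is increasing in
  \<open>\<alpha>\<close>, so \<open>\<alpha>\<^sup>*\<close> minimizes every monotone norm of \<open>\<alpha>\<close> and of \<open>\<Delta>(\<alpha>)\<close>. The minimizer of the
  vector norm is unique although the norm need not be strictly monotone: for \<open>c < c\<^sup>*\<close> the
  difference \<open>\<alpha>(c) - \<alpha>\<^sup>* = (c\<^sup>* - c) q\<close> is positive in every entry, and a monotone norm does
  increase strictly in such a direction (\<open>monotone_norm_strict\<close>).
\<close>

section \<open>Left fixed vectors of irreducible matrices\<close>

text \<open>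
  A vanishing entry \<open>v\<^sub>j = \<Sum>\<^sub>i v\<^sub>i G\<^sub>i\<^sub>j\<close> of a nonnegative fixed vector forces \<open>G\<^sub>i\<^sub>j = 0\<close>
  wherever \<open>v\<^sub>i > 0\<close>. Hence the support of \<open>v\<close> and its complement would violate irreducibility
  if both were nonempty.
\<close>
lemma nonneg_left_fixed_vector_zero:
  fixes G :: "real^'n^'n" and v :: "real^'n"
  assumes "0 \<le> G" "irreducible_matrix G" "v v* G = v" "\<And>i. 0 \<le> v $ i" "v $ k = 0"
  shows "v = 0"
proof (rule ccontr)
  assume "v \<noteq> 0"
  define I where "I = {i. v $ i \<noteq> 0}"
  define J where "J = {i. v $ i = 0}"
  have "I \<noteq> {}" using \<open>v \<noteq> 0\<close> by (auto simp: I_def vec_eq_iff)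
  moreover have "J \<noteq> {}" using assms(5) by (auto simp: J_def)
  moreover have "I \<inter> J = {}" "I \<union> J = UNIV" by (auto simp: I_def J_def)
  moreover have "G $ i $ j = 0" if "i \<in> I" "j \<in> J" for i j
  proof -
    have "(\<Sum>i\<in>UNIV. v $ i * G $ i $ j) = (v v* G) $ j"
      by (simp add: vector_matrix_mult_def mult.commute)
    also have "\<dots> = 0" using assms(3) that(2) by (simp add: J_def)
    finally have "\<forall>i\<in>UNIV. v $ i * G $ i $ j = 0"
      using assms(1,4) by (subst (asm) sum_nonneg_eq_0_iff) (auto simp: less_eq_vec_def)
    then show ?thesis using that(1) by (auto simp: I_def)
  qed
  ultimately have "\<exists>I J. I \<noteq> {} \<and> J \<noteq> {} \<and> I \<inter> J = {} \<and> I \<union> J = UNIV \<and>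
      (\<forall>i\<in>I. \<forall>j\<in>J. G $ i $ j = 0)"
    by (intro exI[of _ I] exI[of _ J]) simp
  with assms(2) show False unfolding irreducible_matrix_def by (rule notE)
qed

text \<open>
  Subtracting from \<open>w\<close> the largest multiple of \<open>m\<close> that keeps it nonnegative leaves a
  nonnegative fixed vector with a zero entry.
\<close>
lemma positive_left_fixed_vector_unique:
  fixes G :: "real^'n^'n" and m w :: "real^'n"
  assumes "0 \<le> G" "irreducible_matrix G" "m v* G = m" "w v* G = w"
    and "\<And>i. 0 < m $ i" "\<And>i. 0 < w $ i"
  obtains c where "0 < c" "w = c *\<^sub>R m"
proof -
  define t where "t = Min (range (\<lambda>i. w $ i / m $ i))"
  have "t \<in> range (\<lambda>i. w $ i / m $ i)" unfolding t_def by (rule Min_in) auto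
  then obtain k where k: "t = w $ k / m $ k" by blast
  have t_le: "t \<le> w $ i / m $ i" for i unfolding t_def by (rule Min_le) auto
  have "w - t *\<^sub>R m = 0"
  proof (rule nonneg_left_fixed_vector_zero[OF assms(1,2)])
    have "(w - t *\<^sub>R m) v* G = w v* G - t *\<^sub>R (m v* G)"
      by (simp only: vector_matrix_mult_diff_distrib scaleR_vector_matrix_assoc)
    then show "(w - t *\<^sub>R m) v* G = w - t *\<^sub>R m" using assms(3,4) by simp
    show "0 \<le> (w - t *\<^sub>R m) $ i" for i
      using t_le[of i] assms(5)[of i] by (simp add: field_simps)
    show "(w - t *\<^sub>R m) $ k = 0" using assms(5)[of k] by (simp add: k)
  qed
  moreover have "0 < t" using assms(5,6)[of k] by (simp add: k)
  ultimately show thesis using that[of t] by simp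
qed

section \<open>The perturbed matrix\<close>

lemma perturbation_nth:
  "perturbation G a $ i $ j = a $ i * ((if i = j then 1 else 0) - G $ i $ j)"
proof -
  have "perturbation G a $ i $ j =
      (\<Sum>k\<in>UNIV. (if i = k then a $ i else 0) * (mat 1 - G) $ k $ j)"
    by (simp add: perturbation_def Diag_def matrix_matrix_mult_def)
  also have "\<dots> = (\<Sum>k\<in>UNIV. if i = k then a $ i * (mat 1 - G) $ k $ j else 0)"
    by (rule sum.cong) auto
  also have "\<dots> = a $ i * (mat 1 - G) $ i $ j" by simp
  finally show ?thesis by (simp add: mat_def)
qed

lemma perturbed_nth:
  "perturbed G a $ i $ j = (1 - a $ i) * G $ i $ j + (if i = j then a $ i else 0)"
  by (simp add: perturbed_def perturbation_nth algebra_simps)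

lemma stochastic_perturbed:
  assumes "stochastic G" "0 \<le> a" "\<And>i. a $ i \<le> 1"
  shows "stochastic (perturbed G a)"
proof -
  have G: "0 \<le> G $ i $ j" "(\<Sum>j\<in>UNIV. G $ i $ j) = 1" for i j
    using assms(1) by (auto simp: stochastic_def less_eq_vec_def vec_eq_iff matrix_vector_mult_def)
  have "0 \<le> perturbed G a $ i $ j" for i j
    using G assms(2,3) by (auto simp: perturbed_nth less_eq_vec_def)
  moreover have "(\<Sum>j\<in>UNIV. perturbed G a $ i $ j) = 1" for i
    by (simp add: perturbed_nth sum.distrib G flip: sum_distrib_left)
  ultimately show ?thesis
    by (simp add: stochastic_def less_eq_vec_def vec_eq_iff matrix_vector_mult_def)
qed

text \<open>
  Irreducibility involves only which off-diagonal entries vanish, and these are multiplied by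
  the nonzero numbers \<open>1 - a\<^sub>i\<close>.
\<close>
lemma irreducible_perturbed:
  assumes "irreducible_matrix G" "\<And>i. a $ i < 1"
  shows "irreducible_matrix (perturbed G a)"
proof -
  have "perturbed G a $ i $ j = 0 \<longleftrightarrow> G $ i $ j = 0" if "i \<noteq> j" for i j
    using that assms(2)[of i] by (simp add: perturbed_nth)
  then have "(\<forall>i\<in>I. \<forall>j\<in>J. perturbed G a $ i $ j = 0) \<longleftrightarrow> (\<forall>i\<in>I. \<forall>j\<in>J. G $ i $ j = 0)"
    if "I \<inter> J = {}" for I J using that by (metis IntI empty_iff)
  with assms(1) show ?thesis unfolding irreducible_matrix_def by (simp cong: conj_cong)
qed

text \<open>Both sides say \<open>(m\<^sup>T - m\<^sup>T D(a)) (I - G) = 0\<close>.\<close>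
lemma perturbed_fixed_iff:
  fixes G :: "real^'n^'n" and a m :: "real^'n"
  shows "m v* perturbed G a = m \<longleftrightarrow>
    (\<chi> i. (1 - a $ i) * m $ i) v* G = (\<chi> i. (1 - a $ i) * m $ i)"
proof -
  have "(m v* perturbed G a) $ j =
      ((\<chi> i. (1 - a $ i) * m $ i) v* G) $ j + a $ j * m $ j" for j
  proof -
    have "(m v* perturbed G a) $ j =
        (\<Sum>i\<in>UNIV. G $ i $ j * ((1 - a $ i) * m $ i) + (if i = j then a $ i * m $ i else 0))"
      unfolding vector_matrix_mult_def vec_lambda_beta
      by (rule sum.cong) (simp_all add: perturbed_nth algebra_simps)
    then show ?thesis
      by (simp add: vector_matrix_mult_def sum.distrib mult.commute mult.left_commute)
  qed
  then have "(m v* perturbed G a) $ j = m $ j \<longleftrightarrow>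
      ((\<chi> i. (1 - a $ i) * m $ i) v* G) $ j = (1 - a $ j) * m $ j" for j
    by (simp only: left_diff_distrib mult_1_left eq_diff_eq)
  then show ?thesis by (simp only: vec_eq_iff vec_lambda_beta)
qed

section \<open>Parameters with a prescribed stationary distribution\<close>

lemma target_params_iff_fixed:
  assumes "stochastic G" "irreducible_matrix G" "\<forall>i. 0 < m $ i" "m \<bullet> 1 = 1"
  shows "a \<in> target_params G m \<longleftrightarrow>
    0 \<le> a \<and> (\<forall>i. a $ i < 1) \<and> m v* perturbed G a = m"
  using assms stochastic_perturbed[of G a] irreducible_perturbed[of G a]
  unfolding target_params_def is_stationary_distribution_def
  by (auto simp: less_imp_le)

lemma le_inverse_infnorm_iff:
  fixes q :: "real^'n"
  assumes "\<And>i. 0 < q $ i" "0 < c"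
  shows "c \<le> 1 / infnorm q \<longleftrightarrow> (\<forall>i. c * q $ i \<le> 1)"
proof -
  have le: "q $ i \<le> infnorm q" for i
    using component_le_infnorm_cart[of q i] by simp
  have pos: "0 < infnorm q"
    using assms(1) le by (meson less_le_trans)
  have "infnorm q \<le> 1 / c \<longleftrightarrow> (\<forall>i. q $ i \<le> 1 / c)"
  proof
    assume "\<forall>i. q $ i \<le> 1 / c"
    then show "infnorm q \<le> 1 / c"
      using assms(1) by (auto simp: infnorm_cart abs_of_pos intro!: cSup_least)
  qed (use le order_trans in blast)
  with pos assms(2) show ?thesis by (simp add: field_simps)
qed

lemma target_params_eq_ray:
  fixes G :: "real^'n^'n" and m m' :: "real^'n"
  assumes "is_stationary_distribution G m" "\<forall>i. 0 < m' $ i" "m' \<bullet> 1 = 1"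
  shows "target_params G m' =
    {alpha_param m m' c |c. 0 < c \<and> c \<le> 1 / infnorm (quotient_vec m m')}"
    (is "?T = ?R")
proof -
  have G: "stochastic G" "0 \<le> G" "irreducible_matrix G" "m v* G = m" "\<And>i. 0 < m $ i"
    using assms(1) by (auto simp: is_stationary_distribution_def stochastic_def)
  note T_iff = target_params_iff_fixed[OF G(1,3) assms(2,3)]
  have q: "0 < quotient_vec m m' $ i" for i
    using G(5) assms(2) by (simp add: quotient_vec_def)
  have alpha: "alpha_param m m' c $ i = 1 - c * quotient_vec m m' $ i" for c i
    by (simp add: alpha_param_def)
  show ?thesis
  proof (intro equalityI subsetI)
    fix a assume "a \<in> ?T"
    then have a: "\<And>i. 0 \<le> a $ i" "\<And>i. a $ i < 1" "m' v* perturbed G a = m'"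
      by (auto simp: T_iff less_eq_vec_def)
    obtain c where c: "0 < c" "(\<chi> i. (1 - a $ i) * m' $ i) = c *\<^sub>R m"
    proof (rule positive_left_fixed_vector_unique[OF G(2,3,4) _ G(5)])
      show "(\<chi> i. (1 - a $ i) * m' $ i) v* G = (\<chi> i. (1 - a $ i) * m' $ i)"
        using a(3) perturbed_fixed_iff by blast
      show "0 < (\<chi> i. (1 - a $ i) * m' $ i) $ i" for i
        using a(2) assms(2) by simp
    qed blast
    have "c * m $ i = (1 - a $ i) * m' $ i" for i
      using c(2) by (simp add: vec_eq_iff)
    then have cq: "c * quotient_vec m m' $ i = 1 - a $ i" for i
      using assms(2) by (simp add: quotient_vec_def order_less_imp_not_eq2)
    then have "a = alpha_param m m' c" by (simp add: vec_eq_iff alpha)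
    moreover have "c \<le> 1 / infnorm (quotient_vec m m')"
      using a(1) by (simp add: le_inverse_infnorm_iff q c(1) cq)
    ultimately show "a \<in> ?R" using c(1) by blast
  next
    fix a assume "a \<in> ?R"
    then obtain c where c: "a = alpha_param m m' c" "0 < c"
      "c \<le> 1 / infnorm (quotient_vec m m')" by blast
    have "0 \<le> a"
      using c by (simp add: le_inverse_infnorm_iff[OF q] less_eq_vec_def alpha)
    moreover have "a $ i < 1" for i using c q by (simp add: alpha)
    moreover have "(\<chi> i. (1 - a $ i) * m' $ i) = c *\<^sub>R m"
      using assms(2) by (simp add: vec_eq_iff c(1) alpha quotient_vec_def order_less_imp_not_eq2)
    then have "m' v* perturbed G a = m'"
      using G(4) by (simp add: perturbed_fixed_iff scaleR_vector_matrix_assoc)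
    ultimately show "a \<in> ?T" by (simp add: T_iff)
  qed
qed

section \<open>Monotone norms\<close>

lemma abs_vec_le_iff: "\<bar>x\<bar> \<le> \<bar>y\<bar> \<longleftrightarrow> (\<forall>i. \<bar>x $ i\<bar> \<le> \<bar>y $ i\<bar>)"
  for x y :: "'a::ordered_euclidean_space^'n"
  by (simp add: less_eq_vec_def abs_vec_def)

lemma monotone_norm_perturbation_mono:
  fixes N :: "real^'n^'n \<Rightarrow> real"
  assumes "monotone_norm N" "0 \<le> a" "a \<le> b"
  shows "N (perturbation G a) \<le> N (perturbation G b)"
proof -
  have "\<bar>a $ i\<bar> \<le> \<bar>b $ i\<bar>" for i
    using assms(2,3) by (simp add: less_eq_vec_def abs_of_nonneg order_trans[of 0 "a $ i" "b $ i"])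
  then have "\<bar>perturbation G a $ i $ j\<bar> \<le> \<bar>perturbation G b $ i $ j\<bar>" for i j
    unfolding perturbation_nth abs_mult by (rule mult_right_mono) simp
  then have "\<bar>perturbation G a\<bar> \<le> \<bar>perturbation G b\<bar>"
    by (simp add: abs_vec_le_iff)
  then show ?thesis using assms(1) by (simp add: monotone_norm_def)
qed

text \<open>
  As \<open>y - x\<close> has no zero entry, \<open>y \<ge> (1 + e) x\<close> for some \<open>e > 0\<close>; so \<open>N y \<ge> (1 + e) N x\<close>,
  and homogeneity supplies the strictness that monotonicity alone does not give.
\<close>
lemma monotone_norm_strict:
  fixes N :: "real^'n \<Rightarrow> real"
  assumes "monotone_norm N" "0 \<le> x" "\<And>i. x $ i < y $ i"
  shows "N x < N y"
proof (cases "x = 0")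
  case True
  then have "y \<noteq> 0" using assms(3) by auto
  then show ?thesis
    using assms(1) True unfolding monotone_norm_def is_norm_def
    by (metis less_le)
next
  case False
  have x: "0 \<le> x $ i" for i using assms(2) by (simp add: less_eq_vec_def)
  have Nx: "0 < N x"
    using assms(1) False unfolding monotone_norm_def is_norm_def by (metis less_le)
  \<comment> \<open>The added 1 keeps the denominator positive at zero entries of \<open>x\<close>.\<close>
  define e where "e = Min (range (\<lambda>i. (y $ i - x $ i) / (x $ i + 1)))"
  have "e \<in> range (\<lambda>i. (y $ i - x $ i) / (x $ i + 1))" unfolding e_def by (rule Min_in) auto
  then have "0 < e" using x assms(3) by (auto intro!: divide_pos_pos add_nonneg_pos)
  have "\<bar>(1 + e) *\<^sub>R x\<bar> \<le> \<bar>y\<bar>"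
    unfolding abs_vec_le_iff
  proof
    fix i
    have "e \<le> (y $ i - x $ i) / (x $ i + 1)" unfolding e_def by (rule Min_le) auto
    then have "e * (x $ i + 1) \<le> y $ i - x $ i"
      using x[of i] by (simp add: pos_le_divide_eq add_nonneg_pos)
    then have "(1 + e) * x $ i \<le> y $ i" using \<open>0 < e\<close> by (simp add: algebra_simps)
    moreover have "0 \<le> (1 + e) * x $ i" using x[of i] \<open>0 < e\<close> by simp
    ultimately show "\<bar>((1 + e) *\<^sub>R x) $ i\<bar> \<le> \<bar>y $ i\<bar>" by simp
  qed
  then have "N ((1 + e) *\<^sub>R x) \<le> N y" using assms(1) by (simp add: monotone_norm_def)
  moreover have "N ((1 + e) *\<^sub>R x) = (1 + e) * N x"
    using assms(1) \<open>0 < e\<close> by (simp add: monotone_norm_def is_norm_def)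
  moreover have "N x < (1 + e) * N x" using Nx \<open>0 < e\<close> by (simp add: algebra_simps)
  ultimately show ?thesis by simp
qed

section \<open>Parameters of minimum norm\<close>

theorem theorem2p2:
  fixes G :: "real^'n^'n" and \<mu> \<mu>' :: "real^'n"
  assumes "stochastic G" and "irreducible_matrix G"
    and "is_stationary_distribution G \<mu>"
    and "\<forall>i. 0 < \<mu>' $ i" and "\<mu>' \<bullet> 1 = 1"
  shows "target_params G \<mu>' =
           {a. 0 \<le> a \<and> (\<forall>i. a $ i < 1) \<and> transpose (perturbed G a) *v \<mu>' = \<mu>'}
       \<and> target_params G \<mu>' =
           {alpha_param \<mu> \<mu>' c |c. 0 < c \<and> c \<le> 1 / infnorm (quotient_vec \<mu> \<mu>')}
       \<and> (\<forall>N :: real^'n \<Rightarrow> real. monotone_norm N \<longrightarrow>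
           (\<forall>a. is_arg_min N (\<lambda>a. a \<in> target_params G \<mu>') a \<longleftrightarrow>
                a = alpha_param \<mu> \<mu>' (1 / infnorm (quotient_vec \<mu> \<mu>'))))
       \<and> (\<forall>N :: real^'n^'n \<Rightarrow> real. monotone_norm N \<longrightarrow>
           is_arg_min (\<lambda>a. N (perturbation G a)) (\<lambda>a. a \<in> target_params G \<mu>')
             (alpha_param \<mu> \<mu>' (1 / infnorm (quotient_vec \<mu> \<mu>'))))"
proof -
  let ?T = "target_params G \<mu>'"
  let ?q = "quotient_vec \<mu> \<mu>'"
  define s where "s = alpha_param \<mu> \<mu>' (1 / infnorm ?q)"
  have fixed: "?T = {a. 0 \<le> a \<and> (\<forall>i. a $ i < 1) \<and> transpose (perturbed G a) *v \<mu>' = \<mu>'}"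
    using target_params_iff_fixed[OF assms(1,2,4,5)] by auto
  note ray = target_params_eq_ray[OF assms(3-5)]
  have q: "0 < ?q $ i" for i
    using assms(3,4) by (simp add: is_stationary_distribution_def quotient_vec_def)
  have "?q \<noteq> 0" using q by (metis less_irrefl zero_index)
  then have "0 < infnorm ?q" by (simp add: infnorm_pos_lt)
  then have s_in: "s \<in> ?T" unfolding ray s_def by auto
  then have s_nonneg: "0 \<le> s" by (simp add: target_params_def)
  have s_less: "\<forall>i. s $ i < a $ i" if "a \<in> ?T" "a \<noteq> s" for a
  proof -
    from that(1) obtain c where c: "a = alpha_param \<mu> \<mu>' c" "c \<le> 1 / infnorm ?q"
      unfolding ray by blast
    with that(2) have "c < 1 / infnorm ?q" unfolding s_def by (metis less_le)
    then have "c * ?q $ i < 1 / infnorm ?q * ?q $ i" for i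
      using q by (rule mult_strict_right_mono)
    then show ?thesis by (simp add: c(1) s_def alpha_param_def)
  qed
  have s_le: "s \<le> a" if "a \<in> ?T" for a
    using s_less[OF that] by (cases "a = s") (auto simp: less_eq_vec_def less_imp_le)
  have "is_arg_min N (\<lambda>a. a \<in> ?T) a \<longleftrightarrow> a = s" if "monotone_norm N"
    for N :: "real^'n \<Rightarrow> real" and a
  proof -
    have "N s < N b" if "b \<in> ?T" "b \<noteq> s" for b
      using monotone_norm_strict[OF \<open>monotone_norm N\<close> s_nonneg] s_less[OF that] by blast
    then show ?thesis using s_in unfolding is_arg_min_def by (metis less_asym less_irrefl)
  qed
  moreover have "is_arg_min (\<lambda>a. N (perturbation G a)) (\<lambda>a. a \<in> ?T) s" if "monotone_norm N"
    for N :: "real^'n^'n \<Rightarrow> real"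
    using monotone_norm_perturbation_mono[OF that s_nonneg s_le] s_in
    by (auto simp: is_arg_min_linorder)
  ultimately show ?thesis using fixed ray unfolding s_def by blast
qed

end
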